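(* Let $\Gamma$ and $\Gamma'$ be finite simple graphs with at least three vertices, let $f:V(\Gamma)\to V(\Gamma')$ be a bijection, and for each $v\in V(\Gamma)$ let $\phi_v:\Gamma-v\to\Gamma'-f(v)$ be a graph isomorphism. Let $\widetilde{\Gamma}$ be the associated directed graph of $(\Gamma,\Gamma',f,\{\phi_v\}_{v\in V(\Gamma)})$. Then at least one of the following holds: (I) there exists a vertex $v\in V(\widetilde{\Gamma})$ with no normal-arrow arising from $v$ in $\widetilde{\Gamma}$ (and then $\Gamma\cong\Gamma'$); (II) for some $v_1,v_2\in V(\widetilde{\Gamma})$, there exist normal-arrows $v_1\longrightarrow v_2$ and $v_2\longrightarrow v_1$ in $\widetilde{\Gamma}$; (III) there exists at least one cycle with alternate normal-arrows and dashed-arrows in $\widetilde{\Gamma}$, and all such cycles are $\beta$-type.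
   Context: $\Gamma-v$ denotes the full (induced) subgraph of $\Gamma$ on $V(\Gamma)\setminus\{v\}$; $E(\Gamma)$ is the edge set and $[u,w]$ denotes an edge joining $u$ and $w$. The associated directed graph $\widetilde{\Gamma}=\widetilde{\Gamma}(\Gamma,\Gamma',f,\{\phi_v\}_{v\in V(\Gamma)})$ has vertex set $V(\widetilde{\Gamma})=V(\Gamma)$ and two kinds of arrows. There is a normal-arrow from $v_1$ to $v_2$, written $v_1\longrightarrow v_2$, if and only if $v_2\ne v_1$, $[v_1,v_2]\notin E(\Gamma)$ and $[f(v_1),\phi_{v_1}(v_2)]\in E(\Gamma')$. There is a dashed-arrow from $v_1$ to $v_2$, written $v_1\dashrightarrow v_2$, if and only if $v_2\neq v_1$, $[f(v_1),f(v_2)]\notin E(\Gamma')$ and $[v_1,\phi_{v_1}^{-1}(f(v_2))]\in E(\Gamma)$. (The condition $v_2\ne v_1$ is needed for $\phi_{v_1}(v_2)$ and $\phi_{v_1}^{-1}(f(v_2))$ to be defined.) An arrow "arises from $v$" if $v$ is its starting vertex. A cycle with alternate normal-arrows and dashed-arrows is a sequence $v_1,\ldots,v_{2k}$ ($k\ge1$) of not necessarily distinct vertices of $\widetilde{\Gamma}$ such that $v_{2i-1}\longrightarrow v_{2i}$ and $v_{2i}\dashrightarrow v_{2i+1}$ for all $i=1,\ldots,k$, where $v_{2k+1}:=v_1$. $\alpha$-type and $\beta$-type. For such a cycle read the indices modulo $2k$, and put $v'_j:=f(v_j)$. Regard each $\phi_{v_j}$ as a partial map from $V(\Gamma)$ to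 $V(\Gamma')$, undefined exactly at $v_j$, and $\phi_{v_j}^{-1}$ as a partial map from $V(\Gamma')$ to $V(\Gamma)$, undefined exactly at $v'_j$. For $t=0,1,\ldots,k-1$ define sequences (whose terms may be undefined, i.e. "blank") $({b'}^{(2t)}_i)_{i\ge1}$ in $V(\Gamma')$ and $(b^{(2t+1)}_i)_{i\ge1}$ in $V(\Gamma)$ by $${b'}^{(2t)}_1=v'_{2t+1},\quad {b'}^{(2t)}_2=\phi_{v_{2t+1}}(v_{2t+2}),\quad {b'}^{(2t)}_3=\phi_{v_{2t+1}}\circ\phi_{v_{2t+2}}^{-1}(v'_{2t+3}),\quad {b'}^{(2t)}_4=\phi_{v_{2t+1}}\circ\phi_{v_{2t+2}}^{-1}\circ\phi_{v_{2t+3}}(v_{2t+4}),\ \ldots$$ $$b^{(2t+1)}_1=v_{2t+2},\quad b^{(2t+1)}_2=\phi_{v_{2t+2}}^{-1}(v'_{2t+3}),\quad b^{(2t+1)}_3=\phi_{v_{2t+2}}^{-1}\circ\phi_{v_{2t+3}}(v_{2t+4}),\ \ldots$$ In general, with $\psi_j:=\phi_{v_j}$ and $x_j:=v'_j$ for $j$ odd, and $\psi_j:=\phi_{v_j}^{-1}$ and $x_j:=v_j$ for $j$ even, the $i$-th term of the sequence with superscript $(s)$ is $\psi_{s+1}\circ\psi_{s+2}\circ\cdots\circ\psi_{s+i-1}(x_{s+i})$; it is blank if at some stage a partial map is applied at a point where it is undefined. The cycle $v_1,\ldots,v_{2k}$ is $\alpha$-type if there is a positive integer $n_0$ such that for every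 $t=0,1,\ldots,k-1$: ${b'}^{(2t)}_i$ and $b^{(2t+1)}_i$ are not blank for all $1\le i\le n_0$; ${b'}^{(2t)}_i$ and $b^{(2t+1)}_i$ are blank for all $i\ge n_0+1$; and ${b'}^{(2t)}_{n_0}=v'_{2t}$ and $b^{(2t+1)}_{n_0}=v_{2t+1}$ (where $v'_0:=v'_{2k}$). Otherwise it is $\beta$-type. *)

theory Defs
  imports Main
begin

section \<open>Finite simple graphs\<close>

record 'a sgraph =
  verts :: "'a set"
  edges :: "'a set set"

definition finite_simple_graph :: "'a sgraph \<Rightarrow> bool" where
  "finite_simple_graph G \<longleftrightarrow>
     finite (verts G) \<and> (\<forall>e\<in>edges G. e \<subseteq> verts G \<and> card e = 2)"

definition delete_vertex :: "'a sgraph \<Rightarrow> 'a \<Rightarrow> 'a sgraph" where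
  "delete_vertex G v =
     \<lparr>verts = verts G - {v}, edges = {e \<in> edges G. e \<subseteq> verts G - {v}}\<rparr>"

definition graph_isomorphism :: "('a \<Rightarrow> 'b) \<Rightarrow> 'a sgraph \<Rightarrow> 'b sgraph \<Rightarrow> bool" where
  "graph_isomorphism h G H \<longleftrightarrow>
     bij_betw h (verts G) (verts H) \<and>
     (\<forall>u\<in>verts G. \<forall>w\<in>verts G. {u, w} \<in> edges G \<longleftrightarrow> {h u, h w} \<in> edges H)"

definition isomorphic_graphs :: "'a sgraph \<Rightarrow> 'b sgraph \<Rightarrow> bool" where
  "isomorphic_graphs G H \<longleftrightarrow> (\<exists>h. graph_isomorphism h G H)"


section \<open>The associated directed graph\<close>

text \<open>
  The isomorphism from \<open>G - v\<close> to \<open>H - f v\<close> is given by a total function \<open>\<phi> v\<close>, whose values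
  outside \<open>verts G - {v}\<close> are irrelevant. The inverse is therefore taken on \<open>verts G - {v}\<close>.
\<close>

definition phi_inv :: "'a sgraph \<Rightarrow> ('a \<Rightarrow> 'a \<Rightarrow> 'b) \<Rightarrow> 'a \<Rightarrow> 'b \<Rightarrow> 'a" where
  "phi_inv G \<phi> v = inv_into (verts G - {v}) (\<phi> v)"

record 'a arrow_digraph =
  dverts :: "'a set"
  normal_arrows :: "('a \<times> 'a) set"
  dashed_arrows :: "('a \<times> 'a) set"

definition associated_digraph ::
  "'a sgraph \<Rightarrow> 'b sgraph \<Rightarrow> ('a \<Rightarrow> 'b) \<Rightarrow> ('a \<Rightarrow> 'a \<Rightarrow> 'b) \<Rightarrow> 'a arrow_digraph" where
  "associated_digraph G H f \<phi> =
     \<lparr>dverts = verts G,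
      normal_arrows = {(v1, v2). v1 \<in> verts G \<and> v2 \<in> verts G \<and> v2 \<noteq> v1 \<and>
        {v1, v2} \<notin> edges G \<and> {f v1, \<phi> v1 v2} \<in> edges H},
      dashed_arrows = {(v1, v2). v1 \<in> verts G \<and> v2 \<in> verts G \<and> v2 \<noteq> v1 \<and>
        {f v1, f v2} \<notin> edges H \<and> {v1, phi_inv G \<phi> v1 (f v2)} \<in> edges G}\<rparr>"


section \<open>Alternating cycles\<close>

text \<open>
  A cycle \<open>v\<^sub>1, \<dots>, v\<^sub>2\<^sub>k\<close> is a list of length \<open>2k\<close>; \<open>cyc vs j\<close> is \<open>v\<^sub>j\<close> with the 1-based index
  \<open>j\<close> read modulo the length, so that \<open>cyc vs 0\<close> is the last vertex.
\<close>

definition cyc :: "'a list \<Rightarrow> nat \<Rightarrow> 'a" where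
  "cyc vs j = vs ! ((j + length vs - 1) mod length vs)"

definition alternating_cycle :: "'a arrow_digraph \<Rightarrow> 'a list \<Rightarrow> bool" where
  "alternating_cycle D vs \<longleftrightarrow>
     (\<exists>k\<ge>1. length vs = 2 * k \<and> set vs \<subseteq> dverts D \<and>
        (\<forall>i\<in>{1..k}. (cyc vs (2 * i - 1), cyc vs (2 * i)) \<in> normal_arrows D \<and>
                     (cyc vs (2 * i), cyc vs (2 * i + 1)) \<in> dashed_arrows D))"


section \<open>Alpha-type and beta-type\<close>

definition phi_map :: "'a sgraph \<Rightarrow> ('a \<Rightarrow> 'a \<Rightarrow> 'b) \<Rightarrow> 'a \<Rightarrow> 'a \<Rightarrow> 'b option" where
  "phi_map G \<phi> v x = (if x \<in> verts G - {v} then Some (\<phi> v x) else None)"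

definition phi_inv_map ::
  "'a sgraph \<Rightarrow> 'b sgraph \<Rightarrow> ('a \<Rightarrow> 'b) \<Rightarrow> ('a \<Rightarrow> 'a \<Rightarrow> 'b) \<Rightarrow> 'a \<Rightarrow> 'b \<Rightarrow> 'a option" where
  "phi_inv_map G H f \<phi> v y =
     (if y \<in> verts H - {f v} then Some (phi_inv G \<phi> v y) else None)"

text \<open>
  The \<open>i\<close>-th term (\<open>i \<ge> 1\<close>) of the sequence with superscript \<open>s\<close> is
  \<open>\<psi>\<^sub>s\<^sub>+\<^sub>1 (\<psi>\<^sub>s\<^sub>+\<^sub>2 (\<dots> (\<psi>\<^sub>s\<^sub>+\<^sub>i\<^sub>-\<^sub>1 x\<^sub>s\<^sub>+\<^sub>i)))\<close>; peeling off the outermost map gives the recursion below, in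
  which superscripts of \<open>b_prime\<close> (terms in \<open>H\<close>) and \<open>b_plain\<close> (terms in \<open>G\<close>) alternate.
  Only even \<open>s\<close> for \<open>b_prime\<close> and odd \<open>s\<close> for \<open>b_plain\<close> are meaningful. \<open>None\<close> is a blank;
  the value at \<open>i = 0\<close> is a dummy.
\<close>

fun b_prime ::
    "'a sgraph \<Rightarrow> 'b sgraph \<Rightarrow> ('a \<Rightarrow> 'b) \<Rightarrow> ('a \<Rightarrow> 'a \<Rightarrow> 'b) \<Rightarrow> 'a list \<Rightarrow> nat \<Rightarrow> nat \<Rightarrow> 'b option"
  and b_plain ::
    "'a sgraph \<Rightarrow> 'b sgraph \<Rightarrow> ('a \<Rightarrow> 'b) \<Rightarrow> ('a \<Rightarrow> 'a \<Rightarrow> 'b) \<Rightarrow> 'a list \<Rightarrow> nat \<Rightarrow> nat \<Rightarrow> 'a option"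
where
  "b_prime G H f \<phi> vs s 0 = None"
| "b_prime G H f \<phi> vs s (Suc 0) = Some (f (cyc vs (s + 1)))"
| "b_prime G H f \<phi> vs s (Suc (Suc i)) =
     Option.bind (b_plain G H f \<phi> vs (s + 1) (Suc i)) (phi_map G \<phi> (cyc vs (s + 1)))"
| "b_plain G H f \<phi> vs s 0 = None"
| "b_plain G H f \<phi> vs s (Suc 0) = Some (cyc vs (s + 1))"
| "b_plain G H f \<phi> vs s (Suc (Suc i)) =
     Option.bind (b_prime G H f \<phi> vs (s + 1) (Suc i)) (phi_inv_map G H f \<phi> (cyc vs (s + 1)))"

definition alpha_type ::
  "'a sgraph \<Rightarrow> 'b sgraph \<Rightarrow> ('a \<Rightarrow> 'b) \<Rightarrow> ('a \<Rightarrow> 'a \<Rightarrow> 'b) \<Rightarrow> 'a list \<Rightarrow> bool" where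
  "alpha_type G H f \<phi> vs \<longleftrightarrow>
     (\<exists>n0\<ge>1. \<forall>t < length vs div 2.
        (\<forall>i\<in>{1..n0}. b_prime G H f \<phi> vs (2 * t) i \<noteq> None \<and>
                       b_plain G H f \<phi> vs (2 * t + 1) i \<noteq> None) \<and>
        (\<forall>i\<ge>n0 + 1. b_prime G H f \<phi> vs (2 * t) i = None \<and>
                      b_plain G H f \<phi> vs (2 * t + 1) i = None) \<and>
        b_prime G H f \<phi> vs (2 * t) n0 = Some (f (cyc vs (2 * t))) \<and>
        b_plain G H f \<phi> vs (2 * t + 1) n0 = Some (cyc vs (2 * t + 1)))"

definition beta_type ::
  "'a sgraph \<Rightarrow> 'b sgraph \<Rightarrow> ('a \<Rightarrow> 'b) \<Rightarrow> ('a \<Rightarrow> 'a \<Rightarrow> 'b) \<Rightarrow> 'a list \<Rightarrow> bool" where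
  "beta_type G H f \<phi> vs \<longleftrightarrow> \<not> alpha_type G H f \<phi> vs"

end

theory Submission
  imports Defs
begin

text \<open>
  Counting edges of the vertex-deleted subgraphs gives equal degrees \<open>deg v = deg (f v)\<close>, so a
  vertex without normal-arrow yields an isomorphism, and a vertex with a normal-arrow also has a
  dashed-arrow. If every vertex has both, following arrows alternately in a finite graph closes up.
  Consecutive terms of the \<open>b\<close>-sequences are adjacent, because the arrows of the cycle make the
  first two terms adjacent and each sequence is, after its first term, the image of the next one
  under an isomorphism. If the cycle is \<open>\<alpha>\<close>-type, then the terms of index \<open>n\<^sub>0 - 1\<close> and \<open>n\<^sub>0\<close> of
  \<open>b'\<^sup>(\<^sup>2\<^sup>)\<close> are \<open>\<phi>\<^bsub>v\<^sub>2\<^esub> v\<^sub>1\<close> and \<open>f v\<^sub>2\<close>; their adjacency is a normal-arrow from \<open>v\<^sub>2\<close> back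
  to \<open>v\<^sub>1\<close>, which is case (II).
\<close>

section \<open>Degrees and edge counts\<close>

definition nbrs :: "'a sgraph \<Rightarrow> 'a \<Rightarrow> 'a set" where
  "nbrs G v = {w. {v, w} \<in> edges G}"

lemma simple_graph_edge:
  assumes "finite_simple_graph G" "{u, w} \<in> edges G"
  shows "u \<in> verts G" "w \<in> verts G" "u \<noteq> w"
proof -
  have "{u, w} \<subseteq> verts G" "card {u, w} = 2"
    using assms unfolding finite_simple_graph_def by blast+
  then show "u \<in> verts G" "w \<in> verts G" "u \<noteq> w" by auto
qed

lemma simple_graph_edgeE:
  assumes "finite_simple_graph G" "e \<in> edges G"
  obtains u w where "e = {u, w}" "u \<in> verts G" "w \<in> verts G" "u \<noteq> w"
proof -
  have "card e = 2" using assms unfolding finite_simple_graph_def by blast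
  then obtain u w where "e = {u, w}" by (meson card_2_iff)
  then show thesis using that simple_graph_edge[OF assms(1)] assms(2) by metis
qed

lemma finite_edges: "finite_simple_graph G \<Longrightarrow> finite (edges G)"
  by (rule finite_subset[of _ "Pow (verts G)"]) (auto simp: finite_simple_graph_def)

lemma nbrs_subset: "finite_simple_graph G \<Longrightarrow> nbrs G v \<subseteq> verts G - {v}"
  unfolding nbrs_def by (auto dest: simple_graph_edge)

lemma finite_nbrs: "finite_simple_graph G \<Longrightarrow> finite (nbrs G v)"
  by (rule finite_subset[OF nbrs_subset]) (auto simp: finite_simple_graph_def)

lemma finite_simple_graph_delete_vertex:
  "finite_simple_graph G \<Longrightarrow> finite_simple_graph (delete_vertex G v)"
  unfolding finite_simple_graph_def delete_vertex_def by auto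

text \<open>\<open>graph_isomorphism\<close> only speaks of pairs of vertices. Simplicity of both
  graphs makes every member of \<open>edges\<close> such a pair, so taking images under
  \<open>h\<close> is a bijection between the edge sets.\<close>

lemma card_edges_graph_isomorphism:
  assumes G: "finite_simple_graph G" and H: "finite_simple_graph H"
    and h: "graph_isomorphism h G H"
  shows "card (edges G) = card (edges H)"
proof -
  have bij: "bij_betw h (verts G) (verts H)"
    and adj: "\<And>u w. u \<in> verts G \<Longrightarrow> w \<in> verts G \<Longrightarrow> {u, w} \<in> edges G \<longleftrightarrow> {h u, h w} \<in> edges H"
    using h unfolding graph_isomorphism_def by auto
  have "inj_on ((`) h) (edges G)"
    using bij_betw_imp_inj_on[OF bij] G unfolding finite_simple_graph_def
    by (meson PowI inj_on_image_Pow inj_on_subset subsetI)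
  moreover have "(`) h ` edges G = edges H"
  proof
    show "(`) h ` edges G \<subseteq> edges H"
    proof
      fix e' assume "e' \<in> (`) h ` edges G"
      then obtain e where e: "e \<in> edges G" "e' = h ` e" by blast
      obtain u w where "e = {u, w}" "u \<in> verts G" "w \<in> verts G"
        using simple_graph_edgeE[OF G e(1)] by blast
      then show "e' \<in> edges H" using e adj by auto
    qed
    show "edges H \<subseteq> (`) h ` edges G"
    proof
      fix e' assume e': "e' \<in> edges H"
      obtain x y where xy: "e' = {x, y}" "x \<in> verts H" "y \<in> verts H"
        using simple_graph_edgeE[OF H e'] by blast
      obtain u w where "u \<in> verts G" "w \<in> verts G" "x = h u" "y = h w"
        using bij xy unfolding bij_betw_def by blast
      then have "{u, w} \<in> edges G" "e' = h ` {u, w}" using e' xy adj by auto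
      then show "e' \<in> (`) h ` edges G" by blast
    qed
  qed
  ultimately show ?thesis using card_image by metis
qed

text \<open>Deleting \<open>v\<close> loses exactly the edges containing \<open>v\<close>, and each
  of these is determined by its other end.\<close>

lemma card_edges_delete_vertex:
  assumes G: "finite_simple_graph G"
  shows "card (edges G) = card (edges (delete_vertex G v)) + card (nbrs G v)"
proof -
  have split: "edges G = edges (delete_vertex G v) \<union> {e \<in> edges G. v \<in> e}"
    using G unfolding finite_simple_graph_def delete_vertex_def by auto
  have "card (edges G) = card (edges (delete_vertex G v)) + card {e \<in> edges G. v \<in> e}"
    by (subst split, rule card_Un_disjoint)
      (use finite_edges[OF G] in \<open>auto simp: delete_vertex_def\<close>)
  moreover have bij: "bij_betw (\<lambda>w. {v, w}) (nbrs G v) {e \<in> edges G. v \<in> e}"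
  proof (rule bij_betwI')
    show "({v, x} = {v, y}) = (x = y)" for x y by (auto simp: doubleton_eq_iff)
    show "{v, x} \<in> {e \<in> edges G. v \<in> e}" if "x \<in> nbrs G v" for x
      using that by (simp add: nbrs_def)
    fix e assume e: "e \<in> {e \<in> edges G. v \<in> e}"
    then obtain u w where uw: "e = {u, w}" using simple_graph_edgeE[OF G] by blast
    then have "e = {v, w} \<or> e = {v, u}" using e by auto
    then show "\<exists>x\<in>nbrs G v. e = {v, x}" using e unfolding nbrs_def by blast
  qed
  ultimately show ?thesis using bij_betw_same_card[OF bij] by simp
qed

text \<open>Double counting: an edge survives the deletion of every vertex except its two
  ends.\<close>

lemma sum_card_edges_delete_vertex:
  assumes G: "finite_simple_graph G"
  shows "(\<Sum>v\<in>verts G. card (edges (delete_vertex G v))) = (card (verts G) - 2) * card (edges G)"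
proof -
  have fin: "finite (verts G)" using G unfolding finite_simple_graph_def by blast
  have "(\<Sum>v\<in>verts G. card (edges (delete_vertex G v)))
      = (\<Sum>v\<in>verts G. \<Sum>e\<in>edges G. if v \<in> e then 0 else 1)"
  proof (rule sum.cong[OF refl])
    fix v
    have "edges (delete_vertex G v) = {e \<in> edges G. v \<notin> e}"
      using G unfolding finite_simple_graph_def delete_vertex_def by auto
    moreover have "card {e \<in> edges G. v \<notin> e} = (\<Sum>e\<in>edges G. if v \<in> e then 0 else 1)"
      using finite_edges[OF G] by (simp add: sum.If_cases Int_def)
    ultimately show "card (edges (delete_vertex G v)) = (\<Sum>e\<in>edges G. if v \<in> e then 0 else 1)"
      by simp
  qed
  also have "\<dots> = (\<Sum>e\<in>edges G. \<Sum>v\<in>verts G. if v \<in> e then 0 else 1)"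
    by (rule sum.swap)
  also have "\<dots> = (\<Sum>e\<in>edges G. card (verts G) - 2)"
  proof (rule sum.cong[OF refl])
    fix e assume e: "e \<in> edges G"
    then have sub: "e \<subseteq> verts G" and "card e = 2" using G unfolding finite_simple_graph_def by auto
    have "(\<Sum>v\<in>verts G. if v \<in> e then 0 else 1) = (\<Sum>v\<in>verts G - e. 1::nat)"
      by (rule sum.mono_neutral_cong_right) (use fin in auto)
    also have "\<dots> = card (verts G) - 2"
      using card_Diff_subset[OF finite_subset[OF sub fin] sub] \<open>card e = 2\<close> by simp
    finally show "(\<Sum>v\<in>verts G. if v \<in> e then 0 else 1) = card (verts G) - 2" .
  qed
  finally show ?thesis by simp
qed

section \<open>Alternating cycles\<close>

lemma cyc_add_length: "cyc vs (j + length vs) = cyc vs j"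
proof (cases vs)
  case (Cons v ws)
  \<comment> \<open>The list is nonempty here, so the truncated subtraction of 1 commutes with
    adding the length.\<close>
  then have "j + length vs + length vs - 1 = (j + length vs - 1) + length vs" by simp
  then show ?thesis unfolding cyc_def by (simp only: mod_add_self2)
qed (simp add: cyc_def)

lemma cyc_add_mult_length: "cyc vs (j + q * length vs) = cyc vs j"
proof (induction q)
  case (Suc q)
  then show ?case using cyc_add_length[of vs "j + q * length vs"] by (simp add: algebra_simps)
qed simp

text \<open>The definition covers a single round; reducing \<open>i\<close> modulo half the length
  extends it to every \<open>i\<close>. This is what the b-sequences require, since their indices
  run past the end of the list.\<close>

lemma alternating_cycle_arrows:
  assumes "alternating_cycle D vs"
  shows "(cyc vs (2 * i + 1), cyc vs (2 * i + 2)) \<in> normal_arrows D"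
    and "(cyc vs (2 * i + 2), cyc vs (2 * i + 3)) \<in> dashed_arrows D"
proof -
  obtain k where k: "k \<ge> 1" "length vs = 2 * k"
    and arr: "\<And>i. i \<in> {1..k} \<Longrightarrow> (cyc vs (2 * i - 1), cyc vs (2 * i)) \<in> normal_arrows D \<and>
                     (cyc vs (2 * i), cyc vs (2 * i + 1)) \<in> dashed_arrows D"
    using assms unfolding alternating_cycle_def by blast
  define r where "r = i mod k"
  have "i = r + i div k * k" unfolding r_def by simp
  then have "2 * i = 2 * r + i div k * length vs"
    unfolding k(2) by (metis add_mult_distrib2 mult.left_commute)
  then have "cyc vs (2 * i + m) = cyc vs (2 * r + m)" for m
    using cyc_add_mult_length[of vs "2 * r + m" "i div k"] by (simp add: algebra_simps)
  moreover have "Suc r \<in> {1..k}" using k(1) unfolding r_def by (simp add: Suc_le_eq)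
  from arr[OF this] have "(cyc vs (2 * r + 1), cyc vs (2 * r + 2)) \<in> normal_arrows D"
    "(cyc vs (2 * r + 2), cyc vs (2 * r + 3)) \<in> dashed_arrows D"
    by (simp_all add: numeral_3_eq_3)
  ultimately show "(cyc vs (2 * i + 1), cyc vs (2 * i + 2)) \<in> normal_arrows D"
    "(cyc vs (2 * i + 2), cyc vs (2 * i + 3)) \<in> dashed_arrows D" by presburger+
qed

text \<open>Needed for cycles of length 2, where superscript 2 lies outside the range of
  \<open>t\<close> in \<open>alpha_type\<close> and has to be read as superscript 0.\<close>

lemma b_add_length:
  "b_prime G H f \<phi> vs (s + length vs) i = b_prime G H f \<phi> vs s i"
  "b_plain G H f \<phi> vs (s + length vs) i = b_plain G H f \<phi> vs s i"
proof (induction G H f \<phi> vs s i and G H f \<phi> vs s i rule: b_prime_b_plain.induct)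
qed (simp_all add: cyc_add_length[where j = "Suc _", simplified])

section \<open>Closing an alternating walk in a finite digraph\<close>

lemma self_map_periodic_point:
  assumes "finite A" "A \<noteq> {}" "\<And>x. x \<in> A \<Longrightarrow> g x \<in> A"
  obtains x p where "x \<in> A" "p \<ge> 1" "(g ^^ p) x = x"
proof -
  obtain a where a: "a \<in> A" using assms(2) by blast
  have iter: "(g ^^ n) a \<in> A" for n by (induction n) (use a assms(3) in auto)
  \<comment> \<open>Pigeonhole: all iterates lie in the finite set \<open>A\<close>, so two of them
    coincide; the earlier one is the periodic point.\<close>
  have "\<not> inj (\<lambda>n. (g ^^ n) a)"
    using finite_subset[OF _ assms(1)] iter finite_imageD infinite_UNIV_nat
    by (metis image_subset_iff)
  then obtain m n where mn: "m < n" "(g ^^ m) a = (g ^^ n) a"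
    unfolding inj_on_def by (metis linorder_neqE_nat)
  have "(g ^^ (n - m)) ((g ^^ m) a) = (g ^^ m) a"
    using mn by (metis add.commute comp_apply funpow_add le_add_diff_inverse less_imp_le)
  then show thesis using that[of "(g ^^ m) a" "n - m"] iter mn by simp
qed

text \<open>Choose one arrow of each kind at every vertex. One application of
  \<open>M \<circ> N\<close> then follows a normal-arrow and a dashed-arrow, so a periodic point of
  this composite starts an alternating cycle.\<close>

lemma alternating_cycle_exists:
  assumes "finite (dverts D)" "dverts D \<noteq> {}"
    and "\<And>v. v \<in> dverts D \<Longrightarrow> \<exists>w\<in>dverts D. (v, w) \<in> normal_arrows D"
    and "\<And>v. v \<in> dverts D \<Longrightarrow> \<exists>w\<in>dverts D. (v, w) \<in> dashed_arrows D"
  shows "\<exists>vs. alternating_cycle D vs"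
proof -
  obtain N where N: "\<And>v. v \<in> dverts D \<Longrightarrow> N v \<in> dverts D \<and> (v, N v) \<in> normal_arrows D"
    using assms(3) by metis
  obtain M where M: "\<And>v. v \<in> dverts D \<Longrightarrow> M v \<in> dverts D \<and> (v, M v) \<in> dashed_arrows D"
    using assms(4) by metis
  define g where "g = M \<circ> N"
  obtain x p where x: "x \<in> dverts D" "p \<ge> 1" "(g ^^ p) x = x"
    using self_map_periodic_point[of "dverts D" g] assms(1,2) M N unfolding g_def
    by (metis comp_apply)
  define w where "w j = (if even j then (g ^^ (j div 2)) x else N ((g ^^ (j div 2)) x))" for j
  define vs where "vs = map w [0..<2 * p]"
  have iter: "(g ^^ n) x \<in> dverts D" for n
    by (induction n) (use x M N in \<open>auto simp: g_def\<close>)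
  \<comment> \<open>The bound includes \<open>j = 2 * p\<close>: there \<open>cyc\<close> wraps
    round to the first vertex, and periodicity gives \<open>w (2 * p) = x = w 0\<close>.\<close>
  have cyc_w: "cyc vs (Suc j) = w j" if "j \<le> 2 * p" for j
  proof (cases "j = 2 * p")
    case True
    then show ?thesis using x by (simp add: cyc_def vs_def w_def)
  next
    case False
    then show ?thesis using that by (simp add: cyc_def vs_def)
  qed
  have "(cyc vs (2 * i - 1), cyc vs (2 * i)) \<in> normal_arrows D \<and>
        (cyc vs (2 * i), cyc vs (2 * i + 1)) \<in> dashed_arrows D" if i: "i \<in> {1..p}" for i
  proof -
    obtain j where j: "i = Suc j" using i by (cases i) auto
    have "cyc vs (2 * i - 1) = w (2 * j)" "cyc vs (2 * i) = w (Suc (2 * j))"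
      "cyc vs (2 * i + 1) = w (Suc (Suc (2 * j)))"
      using cyc_w[of "2 * j"] cyc_w[of "Suc (2 * j)"] cyc_w[of "Suc (Suc (2 * j))"] i j by auto
    moreover have "w (Suc (Suc (2 * j))) = M (w (Suc (2 * j)))" "w (Suc (2 * j)) = N (w (2 * j))"
      "w (2 * j) \<in> dverts D"
      using iter[of j] by (simp_all add: w_def g_def)
    ultimately show ?thesis using M N by metis
  qed
  moreover have "set vs \<subseteq> dverts D" using iter N by (auto simp: vs_def w_def)
  moreover have "length vs = 2 * p" by (simp add: vs_def)
  ultimately show ?thesis using x(2) unfolding alternating_cycle_def by blast
qed

section \<open>Hypomorphic graphs\<close>

locale hypomorphism =
  fixes G :: "'a sgraph" and H :: "'b sgraph"
    and f :: "'a \<Rightarrow> 'b" and \<phi> :: "'a \<Rightarrow> 'a \<Rightarrow> 'b"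
  assumes simple_G: "finite_simple_graph G" and simple_H: "finite_simple_graph H"
    and card_G: "card (verts G) \<ge> 3"
    and bij_f: "bij_betw f (verts G) (verts H)"
    and iso_\<phi>: "\<And>v. v \<in> verts G \<Longrightarrow>
      graph_isomorphism (\<phi> v) (delete_vertex G v) (delete_vertex H (f v))"
begin

abbreviation "D \<equiv> associated_digraph G H f \<phi>"

section \<open>The vertex-deleted isomorphisms and their inverses\<close>

lemma f_in: "v \<in> verts G \<Longrightarrow> f v \<in> verts H"
  using bij_f by (auto dest: bij_betwE)

lemma bij_\<phi>: "v \<in> verts G \<Longrightarrow> bij_betw (\<phi> v) (verts G - {v}) (verts H - {f v})"
  using iso_\<phi> unfolding graph_isomorphism_def delete_vertex_def by auto

lemma \<phi>_edge:
  assumes v: "v \<in> verts G" and "u \<in> verts G - {v}" "w \<in> verts G - {v}"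
  shows "{\<phi> v u, \<phi> v w} \<in> edges H \<longleftrightarrow> {u, w} \<in> edges G"
proof -
  have "\<phi> v u \<in> verts H - {f v}" "\<phi> v w \<in> verts H - {f v}"
    using bij_\<phi>[OF v] assms(2,3) by (auto dest: bij_betwE)
  then show ?thesis
    using iso_\<phi>[OF v] assms(2,3) unfolding graph_isomorphism_def delete_vertex_def by auto
qed

lemma phi_inv_in:
  assumes "v \<in> verts G" "y \<in> verts H - {f v}"
  shows "phi_inv G \<phi> v y \<in> verts G - {v}"
  using bij_betwE[OF bij_betw_inv_into[OF bij_\<phi>[OF assms(1)]]] assms(2)
  unfolding phi_inv_def by blast

lemma \<phi>_phi_inv:
  assumes "v \<in> verts G" "y \<in> verts H - {f v}"
  shows "\<phi> v (phi_inv G \<phi> v y) = y"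
  unfolding phi_inv_def by (rule bij_betw_inv_into_right[OF bij_\<phi>[OF assms(1)] assms(2)])

lemma phi_inv_\<phi>:
  assumes "v \<in> verts G" "x \<in> verts G - {v}"
  shows "phi_inv G \<phi> v (\<phi> v x) = x"
  unfolding phi_inv_def by (rule bij_betw_inv_into_left[OF bij_\<phi>[OF assms(1)] assms(2)])

text \<open>Corresponding vertex-deleted subgraphs have equally many edges. Summing over all
  vertices and cancelling \<open>card (verts G) - 2\<close>, which is positive by
  \<open>card_G\<close>, gives equal edge totals; a degree is the total minus the edges left after
  deletion.\<close>

lemma card_nbrs_f:
  assumes "v \<in> verts G"
  shows "card (nbrs H (f v)) = card (nbrs G v)"
proof -
  have del: "card (edges (delete_vertex H (f u))) = card (edges (delete_vertex G u))"
    if "u \<in> verts G" for u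
    using card_edges_graph_isomorphism[OF _ _ iso_\<phi>[OF that]]
      finite_simple_graph_delete_vertex simple_G simple_H by metis
  have card_eq: "card (verts H) = card (verts G)" using bij_betw_same_card[OF bij_f] by simp
  have "(card (verts G) - 2) * card (edges H)
      = (\<Sum>y\<in>verts H. card (edges (delete_vertex H y)))"
    using sum_card_edges_delete_vertex[OF simple_H] card_eq by simp
  also have "\<dots> = (\<Sum>u\<in>verts G. card (edges (delete_vertex H (f u))))"
    using sum.reindex_bij_betw[OF bij_f, of "\<lambda>y. card (edges (delete_vertex H y))"] by simp
  also have "\<dots> = (\<Sum>u\<in>verts G. card (edges (delete_vertex G u)))"
    by (rule sum.cong) (use del in auto)
  also have "\<dots> = (card (verts G) - 2) * card (edges G)"
    by (rule sum_card_edges_delete_vertex[OF simple_G])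
  finally have "card (edges H) = card (edges G)" using card_G by simp
  then show ?thesis
    using card_edges_delete_vertex[OF simple_G, of v] card_edges_delete_vertex[OF simple_H, of "f v"]
      del[OF assms] by simp
qed

lemma card_image_nbrs:
  assumes v: "v \<in> verts G"
  shows "card (\<phi> v ` nbrs G v) = card (nbrs H (f v))"
proof -
  have "inj_on (\<phi> v) (nbrs G v)"
    using bij_\<phi>[OF v] nbrs_subset[OF simple_G] by (metis bij_betw_def inj_on_subset)
  then show ?thesis using card_nbrs_f[OF v] by (simp add: card_image)
qed

text \<open>Normal-arrows from \<open>v\<close> correspond to the neighbours of \<open>f v\<close>
  that lie outside the image of \<open>nbrs G v\<close> under \<open>\<phi> v\<close>, and
  dashed-arrows to the points of this image that are not neighbours of \<open>f v\<close>. Hence the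
  absence of either kind is an inclusion between these two sets.\<close>

lemma nbrs_H_subset_if_no_normal_arrow:
  assumes v: "v \<in> verts G" and no: "\<And>w. (v, w) \<notin> normal_arrows D"
  shows "nbrs H (f v) \<subseteq> \<phi> v ` nbrs G v"
proof
  fix y assume y: "y \<in> nbrs H (f v)"
  then have yH: "y \<in> verts H - {f v}" using nbrs_subset[OF simple_H] by blast
  let ?x = "phi_inv G \<phi> v y"
  have x: "?x \<in> verts G - {v}" "\<phi> v ?x = y" using phi_inv_in[OF v yH] \<phi>_phi_inv[OF v yH] .
  have "{v, ?x} \<in> edges G"
    using no[of ?x] x y v unfolding associated_digraph_def nbrs_def by auto
  then show "y \<in> \<phi> v ` nbrs G v" using x(2) unfolding nbrs_def by (metis imageI mem_Collect_eq)
qed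

lemma image_nbrs_subset_if_no_dashed_arrow:
  assumes v: "v \<in> verts G" and no: "\<And>w. (v, w) \<notin> dashed_arrows D"
  shows "\<phi> v ` nbrs G v \<subseteq> nbrs H (f v)"
proof
  fix y assume "y \<in> \<phi> v ` nbrs G v"
  then obtain x where x: "x \<in> nbrs G v" "y = \<phi> v x" by blast
  then have xG: "x \<in> verts G - {v}" using nbrs_subset[OF simple_G] by blast
  then have "y \<in> verts H - {f v}" using bij_\<phi>[OF v] x(2) by (auto dest: bij_betwE)
  \<comment> \<open>The end of a dashed-arrow enters through \<open>f\<close>, so \<open>y\<close>
    is pulled back by \<open>f\<close> and not by \<open>\<phi> v\<close>.\<close>
  then obtain w where w: "w \<in> verts G" "f w = y" "w \<noteq> v"
    using bij_f unfolding bij_betw_def by (metis DiffE imageE singletonI)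
  have "{v, phi_inv G \<phi> v (f w)} \<in> edges G"
    using phi_inv_\<phi>[OF v xG] x w unfolding nbrs_def by simp
  then have "{f v, f w} \<in> edges H"
    using no[of w] v w unfolding associated_digraph_def by auto
  then show "y \<in> nbrs H (f v)" using w unfolding nbrs_def by simp
qed

text \<open>An inclusion between finite sets of equal size is an equality, so
  \<open>\<phi> v\<close> carries the neighbours of \<open>v\<close> onto those of
  \<open>f v\<close>. Extending it by sending \<open>v\<close> to \<open>f v\<close> therefore also
  respects the edges at \<open>v\<close>.\<close>

lemma isomorphic_if_no_normal_arrow:
  assumes v: "v \<in> verts G" and no: "\<And>w. (v, w) \<notin> normal_arrows D"
  shows "isomorphic_graphs G H"
proof -
  have nb: "nbrs H (f v) = \<phi> v ` nbrs G v"
    using card_subset_eq[OF _ nbrs_H_subset_if_no_normal_arrow[OF v no]] card_image_nbrs[OF v]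
      finite_nbrs[OF simple_G] by simp
  have star: "{f v, \<phi> v w} \<in> edges H \<longleftrightarrow> {v, w} \<in> edges G" if w: "w \<in> verts G - {v}" for w
  proof -
    have "\<phi> v w \<in> \<phi> v ` nbrs G v \<longleftrightarrow> w \<in> nbrs G v"
      using inj_on_image_mem_iff[OF _ w nbrs_subset[OF simple_G]] bij_\<phi>[OF v]
      by (metis bij_betw_def)
    then show ?thesis using nb unfolding nbrs_def by auto
  qed
  \<comment> \<open>\<open>graph_isomorphism\<close> also ranges over \<open>u = w\<close>, where
    the pair is a singleton; for \<open>u = w = v\<close> both sides are false.\<close>
  have loop: "{x} \<notin> edges G" "{y} \<notin> edges H" for x y
    using simple_graph_edge(3)[OF simple_G, of x x] simple_graph_edge(3)[OF simple_H, of y y] by auto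
  let ?h = "(\<phi> v)(v := f v)"
  have "bij_betw ?h (insert v (verts G - {v})) (insert (f v) (verts H - {f v}))"
  proof (rule bij_betw_combine[of ?h "{v}" "{f v}", simplified])
    show "bij_betw ?h (verts G - {v}) (verts H - {f v})"
      using bij_\<phi>[OF v] by (rule bij_betw_cong[THEN iffD1, rotated]) auto
  qed (auto simp: bij_betw_def)
  then have "bij_betw ?h (verts G) (verts H)"
    using v f_in[OF v] by (simp add: insert_absorb)
  moreover have "{u, w} \<in> edges G \<longleftrightarrow> {?h u, ?h w} \<in> edges H"
    if "u \<in> verts G" "w \<in> verts G" for u w
    using that star[of u] star[of w] \<phi>_edge[OF v, of u w] loop
    by (cases "u = v"; cases "w = v") (auto simp: insert_commute)
  ultimately show ?thesis unfolding isomorphic_graphs_def graph_isomorphism_def by blast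
qed

text \<open>The image of \<open>nbrs G v\<close> and the set \<open>nbrs H (f v)\<close> have the
  same size, so if one has a point outside the other, the converse holds too.\<close>

lemma dashed_arrow_if_normal_arrow:
  assumes vw: "(v, w) \<in> normal_arrows D"
  shows "\<exists>u\<in>verts G. (v, u) \<in> dashed_arrows D"
proof (rule ccontr)
  have v: "v \<in> verts G" and w: "w \<in> verts G - {v}"
    and non: "w \<notin> nbrs G v" and adj: "\<phi> v w \<in> nbrs H (f v)"
    using vw unfolding associated_digraph_def nbrs_def by auto
  assume "\<not> ?thesis"
  then have "(v, u) \<notin> dashed_arrows D" for u unfolding associated_digraph_def by auto
  from card_subset_eq[OF _ image_nbrs_subset_if_no_dashed_arrow[OF v this]]
  have "\<phi> v ` nbrs G v = nbrs H (f v)"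
    using card_image_nbrs[OF v] finite_nbrs[OF simple_H] by simp
  then show False
    using adj non inj_on_image_mem_iff[OF _ w nbrs_subset[OF simple_G]] bij_\<phi>[OF v]
    by (metis bij_betw_def)
qed

section \<open>Alpha-type cycles\<close>

text \<open>Both sequences share one induction with \<open>t\<close> arbitrary, since stripping the
  outermost map raises the superscript by one and switches the graph. The base case is the edge half
  of the normal-arrow condition for \<open>b_prime\<close> and of the dashed-arrow condition for
  \<open>b_plain\<close>.\<close>

lemma b_consecutive_adjacent:
  assumes cyc: "alternating_cycle D vs"
  shows "b_prime G H f \<phi> vs (2 * t) (Suc i) = Some x \<Longrightarrow>
      b_prime G H f \<phi> vs (2 * t) (Suc (Suc i)) = Some y \<Longrightarrow> {x, y} \<in> edges H"
    and "b_plain G H f \<phi> vs (2 * t + 1) (Suc i) = Some u \<Longrightarrow>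
      b_plain G H f \<phi> vs (2 * t + 1) (Suc (Suc i)) = Some w \<Longrightarrow> {u, w} \<in> edges G"
proof (induction i arbitrary: t x y u w)
  case 0
  {
    case 1
    then show ?case
      using alternating_cycle_arrows(1)[OF cyc, of t]
      by (auto simp: phi_map_def associated_digraph_def split: if_splits)
  next
    case 2
    then show ?case
      using alternating_cycle_arrows(2)[OF cyc, of t]
      by (auto simp: phi_inv_map_def associated_digraph_def numeral_3_eq_3 split: if_splits)
  }
next
  case (Suc i)
  {
    case 1
    let ?v = "cyc vs (2 * t + 1)"
    obtain x' y' where xy: "b_plain G H f \<phi> vs (2 * t + 1) (Suc i) = Some x'"
      "b_plain G H f \<phi> vs (2 * t + 1) (Suc (Suc i)) = Some y'"
      "phi_map G \<phi> ?v x' = Some x" "phi_map G \<phi> ?v y' = Some y"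
      using 1 by (auto simp: bind_eq_Some_conv simp del: b_plain.simps)
    have "?v \<in> verts G"
      using alternating_cycle_arrows(1)[OF cyc, of t] unfolding associated_digraph_def by auto
    then show ?case
      using Suc.IH(2)[OF xy(1,2)] xy(3,4) \<phi>_edge[of ?v x' y']
      by (auto simp: phi_map_def split: if_splits)
  next
    case 2
    let ?v = "cyc vs (2 * t + 2)"
    \<comment> \<open>Superscript \<open>2 * t + 2\<close> is written \<open>2 * Suc t\<close> so
      that the induction hypothesis applies at \<open>Suc t\<close>.\<close>
    obtain u' w' where uw: "b_prime G H f \<phi> vs (2 * Suc t) (Suc i) = Some u'"
      "b_prime G H f \<phi> vs (2 * Suc t) (Suc (Suc i)) = Some w'"
      "phi_inv_map G H f \<phi> ?v u' = Some u" "phi_inv_map G H f \<phi> ?v w' = Some w"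
      using 2 by (auto simp: bind_eq_Some_conv simp del: b_prime.simps)
    have v: "?v \<in> verts G"
      using alternating_cycle_arrows(1)[OF cyc, of t] unfolding associated_digraph_def by auto
    have "u' \<in> verts H - {f ?v}" "u = phi_inv G \<phi> ?v u'"
      "w' \<in> verts H - {f ?v}" "w = phi_inv G \<phi> ?v w'"
      using uw(3,4) by (auto simp: phi_inv_map_def split: if_splits)
    then show ?case
      using Suc.IH(1)[OF uw(1,2)] \<phi>_edge[OF v, of u w] phi_inv_in[OF v] \<phi>_phi_inv[OF v] by metis
  }
qed

text \<open>The closing condition at superscript 1 determines the last but one term at superscript
  2, and the closing condition at superscript 2 its last term. The non-edge required for the reverse
  arrow is that of the original arrow, by symmetry.\<close>

lemma alpha_type_reverse_normal_arrow:
  assumes cyc: "alternating_cycle D vs" and \<alpha>: "alpha_type G H f \<phi> vs"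
  shows "(cyc vs 2, cyc vs 1) \<in> normal_arrows D"
proof -
  obtain k where k: "k \<ge> 1" "length vs = 2 * k"
    using cyc unfolding alternating_cycle_def by blast
  obtain n where n: "n \<ge> 1"
    and last: "\<And>t. t < k \<Longrightarrow> b_prime G H f \<phi> vs (2 * t) n = Some (f (cyc vs (2 * t)))"
      "\<And>t. t < k \<Longrightarrow> b_plain G H f \<phi> vs (2 * t + 1) n = Some (cyc vs (2 * t + 1))"
    using \<alpha> k(2) unfolding alpha_type_def by auto
  have arr: "cyc vs 1 \<in> verts G" "cyc vs 2 \<in> verts G" "cyc vs 2 \<noteq> cyc vs 1"
    "{cyc vs 1, cyc vs 2} \<notin> edges G"
    using alternating_cycle_arrows(1)[OF cyc, of 0] unfolding associated_digraph_def
    by (auto simp: numeral_2_eq_2)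
  have plain: "b_plain G H f \<phi> vs 1 n = Some (cyc vs 1)" using last(2)[of 0] k(1) by simp
  \<comment> \<open>For \<open>n = 1\<close> the closing term would be the first term
    \<open>cyc vs 2\<close>, which differs from \<open>cyc vs 1\<close>. So a term of index
    \<open>n - 1\<close> exists.\<close>
  have "n \<noteq> 1" using plain arr(3) by (auto simp: numeral_2_eq_2)
  then obtain m where m: "n = Suc (Suc m)"
    using n that[of "n - 2"] by simp
  have prime: "b_prime G H f \<phi> vs 2 n = Some (f (cyc vs 2))"
  \<comment> \<open>Superscript 2 is the case \<open>t = 1\<close> of \<open>last(1)\<close>,
    available only for \<open>k > 1\<close>; for \<open>k = 1\<close> periodicity reduces it to
    \<open>t = 0\<close>.\<close>
  proof (cases "k = 1")
    case True
    then have "length vs = 2" using k(2) by simp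
    then have "b_prime G H f \<phi> vs 2 n = b_prime G H f \<phi> vs 0 n" "cyc vs 2 = cyc vs 0"
      using b_add_length(1)[of G H f \<phi> vs 0 n] cyc_add_length[of vs 0] by (simp_all add: numeral_2_eq_2)
    then show ?thesis using last(1)[of 0] k(1) by simp
  next
    case False
    then show ?thesis using last(1)[of 1] k(1) by simp
  qed
  obtain y where y: "b_prime G H f \<phi> vs 2 (Suc m) = Some y"
    "phi_inv_map G H f \<phi> (cyc vs 2) y = Some (cyc vs 1)"
    using plain m by (auto simp: bind_eq_Some_conv numeral_2_eq_2 simp del: b_prime.simps)
  then have "\<phi> (cyc vs 2) (cyc vs 1) = y"
    using \<phi>_phi_inv[OF arr(2), of y] by (auto simp: phi_inv_map_def split: if_splits)
  moreover have "{y, f (cyc vs 2)} \<in> edges H"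
    using b_consecutive_adjacent(1)[OF cyc, of 1 m] y(1) prime m by simp
  ultimately show ?thesis
    using arr unfolding associated_digraph_def by (auto simp: insert_commute)
qed

end

theorem corollary4p3:
  fixes G :: "'a sgraph" and H :: "'b sgraph"
    and f :: "'a \<Rightarrow> 'b" and \<phi> :: "'a \<Rightarrow> 'a \<Rightarrow> 'b"
  assumes "finite_simple_graph G" and "finite_simple_graph H"
    and "card (verts G) \<ge> 3" and "card (verts H) \<ge> 3"
    and "bij_betw f (verts G) (verts H)"
    and "\<forall>v\<in>verts G. graph_isomorphism (\<phi> v) (delete_vertex G v) (delete_vertex H (f v))"
  shows "let D = associated_digraph G H f \<phi>;
             case_I = (\<exists>v\<in>dverts D. \<not> (\<exists>w. (v, w) \<in> normal_arrows D));
             case_II = (\<exists>v1\<in>dverts D. \<exists>v2\<in>dverts D.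
               (v1, v2) \<in> normal_arrows D \<and> (v2, v1) \<in> normal_arrows D);
             case_III = ((\<exists>vs. alternating_cycle D vs) \<and>
               (\<forall>vs. alternating_cycle D vs \<longrightarrow> beta_type G H f \<phi> vs))
         in (case_I \<or> case_II \<or> case_III) \<and> (case_I \<longrightarrow> isomorphic_graphs G H)"
proof -
  interpret hypomorphism G H f \<phi>
    using assms by unfold_locales auto
  have verts: "dverts D = verts G" by (simp add: associated_digraph_def)
  have arrow_verts: "v \<in> verts G \<and> w \<in> verts G" if "(v, w) \<in> normal_arrows D" for v w
    using that by (auto simp: associated_digraph_def)
  have "\<exists>vs. alternating_cycle D vs" if normal: "\<forall>v\<in>verts G. \<exists>w. (v, w) \<in> normal_arrows D"
  proof (rule alternating_cycle_exists)
    show "finite (dverts D)" using simple_G verts unfolding finite_simple_graph_def by simp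
    show "dverts D \<noteq> {}" using card_G verts by auto
    fix v assume "v \<in> dverts D"
    then obtain w where w: "(v, w) \<in> normal_arrows D" using normal verts by auto
    then show "\<exists>w\<in>dverts D. (v, w) \<in> normal_arrows D" using arrow_verts verts by blast
    show "\<exists>w\<in>dverts D. (v, w) \<in> dashed_arrows D"
      using dashed_arrow_if_normal_arrow[OF w] verts by simp
  qed
  \<comment> \<open>Contrapositive form: once case (II) fails, every alternating cycle is
    \<open>\<beta>\<close>-type.\<close>
  moreover have "\<exists>v1\<in>verts G. \<exists>v2\<in>verts G.
      (v1, v2) \<in> normal_arrows D \<and> (v2, v1) \<in> normal_arrows D"
    if "alternating_cycle D vs" "\<not> beta_type G H f \<phi> vs" for vs
    using alpha_type_reverse_normal_arrow[OF that(1)] alternating_cycle_arrows(1)[OF that(1), of 0]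
      that(2) arrow_verts unfolding beta_type_def by (auto simp: numeral_2_eq_2)
  moreover have "isomorphic_graphs G H"
    if "\<exists>v\<in>verts G. \<not> (\<exists>w. (v, w) \<in> normal_arrows D)"
    using that isomorphic_if_no_normal_arrow by blast
  ultimately show ?thesis unfolding Let_def verts by blast
qed

end
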